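(* In the single-item environment with $n$ real bidders whose values are drawn i.i.d. from the exponential distribution with mean $1$, a collateral equal to the monopoly reserve $1$ is necessary for the Deferred-Revelation Auction (DRA) over a public ledger, as described in the context, to be credible; that is, the DRA is not credible for any collateral $f<1$.
   Context: Bidders are quasi-linear with independent values; the exponential distribution with mean $1$ has CDF $1-e^{-t}$, virtual value $\varphi(v)=v-1$, monopoly reserve $1$. In the single-item environment at most one bidder may be allocated. DRA over a public ledger (visible to all) with a perfectly hiding, perfectly binding, non-malleable commitment scheme: (1) every participant (real bidders and any fake bids fabricated by the auctioneer) commits to an identifier and a bid and deposits collateral $f$; the auctioneer declares a matroid feasibility constraint $\hat{\mathcal{F}}$ and distributions $\hat D_j$ (virtual values $\hat\varphi_j$) for all committed bids; (2) each committed bid is revealed or concealed, and collateral of concealed bids is burnt; (3) among revealed bids, the set $S\in\hat{\mathcal{F}}$ maximizing $\sum_{i\in S}\hat\varphi_i(b_i)$ (lexicographic tie-breaking) is allocated, each allocated bidder paying its critical bid. The auctioneer may fabricate bids, misreport distributions and constraint (keeping the allocated real bidders feasible in the true constraint), and choose which fake bids to conceal after seeing revealed real bids. Its revenue is real bidders' payments minus burnt collateral of its concealed fake bids. The DRA is credible for collateral $f$ if, when real bidders bid truthfully, the auctioneer maximizes expected revenue by fabricating no bids and reporting true distributions and constraint. *)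

theory Defs
  imports "HOL-Probability.Probability"
begin

definition matroid :: "'a set \<Rightarrow> 'a set set \<Rightarrow> bool" where
  "matroid E F \<longleftrightarrow> finite E \<and> (\<forall>S\<in>F. S \<subseteq> E) \<and> {} \<in> F
     \<and> (\<forall>A B. B \<in> F \<longrightarrow> A \<subseteq> B \<longrightarrow> A \<in> F)
     \<and> (\<forall>A\<in>F. \<forall>B\<in>F. card A < card B \<longrightarrow> (\<exists>x\<in>B - A. insert x A \<in> F))"

text \<open>Bids (committed participants) are identified by natural numbers; real bidders are
  0,...,n-1, fake bids n,...,n+m-1.  Lexicographic tie-breaking: among two distinct sets,
  the one containing the smallest element of their symmetric difference is preferred.\<close>

definition lex_pref :: "nat set \<Rightarrow> nat set \<Rightarrow> bool" where
  "lex_pref S T \<longleftrightarrow> S \<noteq> T \<and> Min ((S - T) \<union> (T - S)) \<in> S"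

definition candidates :: "nat set set \<Rightarrow> nat set \<Rightarrow> nat set set" where
  "candidates F R = {S \<in> F. S \<subseteq> R}"

text \<open>phi j is the declared virtual-value function of bid j, b the bid vector.\<close>
definition alloc :: "nat set set \<Rightarrow> (nat \<Rightarrow> real \<Rightarrow> real) \<Rightarrow> (nat \<Rightarrow> real) \<Rightarrow> nat set \<Rightarrow> nat set" where
  "alloc F phi b R = (THE S. S \<in> candidates F R \<and>
      (\<forall>T\<in>candidates F R. T \<noteq> S \<longrightarrow>
          (\<Sum>i\<in>T. phi i (b i)) < (\<Sum>i\<in>S. phi i (b i))
        \<or> ((\<Sum>i\<in>T. phi i (b i)) = (\<Sum>i\<in>S. phi i (b i)) \<and> lex_pref S T)))"

definition critical_bid :: "nat set set \<Rightarrow> (nat \<Rightarrow> real \<Rightarrow> real) \<Rightarrow> (nat \<Rightarrow> real) \<Rightarrow> nat set \<Rightarrow> nat \<Rightarrow> real" where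
  "critical_bid F phi b R i = Inf {x. 0 \<le> x \<and> i \<in> alloc F phi (b(i := x)) R}"

record strategy =
  nfake   :: nat
  fakebid :: "nat \<Rightarrow> real"               \<comment> \<open>committed value of fake bid j (j \<ge> n)\<close>
  vval    :: "nat \<Rightarrow> real \<Rightarrow> real"
  feas    :: "nat set set"
  conceal :: "(nat \<Rightarrow> real) \<Rightarrow> nat set"  \<comment> \<open>fake bids concealed, given the revealed real bids\<close>

definition valid_strategy :: "nat \<Rightarrow> strategy \<Rightarrow> bool" where
  "valid_strategy n \<sigma> \<longleftrightarrow>
     matroid {..<n + nfake \<sigma>} (feas \<sigma>)
   \<and> (\<forall>S\<in>feas \<sigma>. card (S \<inter> {..<n}) \<le> 1)
   \<and> (\<forall>j. mono (vval \<sigma> j))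
   \<and> (\<forall>v. conceal \<sigma> v \<subseteq> {n..<n + nfake \<sigma>})"

definition bids :: "nat \<Rightarrow> strategy \<Rightarrow> (nat \<Rightarrow> real) \<Rightarrow> nat \<Rightarrow> real" where
  "bids n \<sigma> v i = (if i < n then v i else fakebid \<sigma> i)"

definition revealed :: "nat \<Rightarrow> strategy \<Rightarrow> (nat \<Rightarrow> real) \<Rightarrow> nat set" where
  "revealed n \<sigma> v = {..<n + nfake \<sigma>} - conceal \<sigma> v"

text \<open>Auctioneer revenue: payments of allocated real bidders minus burnt collateral of
  concealed fake bids.\<close>
definition DRA_revenue :: "nat \<Rightarrow> real \<Rightarrow> strategy \<Rightarrow> (nat \<Rightarrow> real) \<Rightarrow> real" where
  "DRA_revenue n f \<sigma> v =
     (let b = bids n \<sigma> v; R = revealed n \<sigma> v;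
          A = alloc (feas \<sigma>) (vval \<sigma>) b R
      in (\<Sum>i\<in>A \<inter> {..<n}. critical_bid (feas \<sigma>) (vval \<sigma>) b R i)
         - f * real (card (conceal \<sigma> v)))"

abbreviation exp1 :: "real measure" where
  "exp1 \<equiv> density lborel (exponential_density 1)"

definition expected_revenue :: "nat \<Rightarrow> real \<Rightarrow> strategy \<Rightarrow> real" where
  "expected_revenue n f \<sigma> = (\<integral>v. DRA_revenue n f \<sigma> v \<partial>(PiM {..<n} (\<lambda>_. exp1)))"

text \<open>Honest behaviour: no fake bids, true distributions (virtual value v - 1 for Exp(1)),
  true single-item constraint, nothing concealed.\<close>
definition honest :: "nat \<Rightarrow> strategy" where
  "honest n = \<lparr> nfake = 0, fakebid = (\<lambda>_. 0), vval = (\<lambda>_ x. x - 1),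
               feas = {S. S \<subseteq> {..<n} \<and> card S \<le> 1}, conceal = (\<lambda>_. {}) \<rparr>"

definition DRA_credible :: "nat \<Rightarrow> real \<Rightarrow> bool" where
  "DRA_credible n f \<longleftrightarrow>
     (\<forall>\<sigma>. valid_strategy n \<sigma> \<longrightarrow> expected_revenue n f \<sigma> \<le> expected_revenue n f (honest n))"

end

theory Submission
  imports Defs
begin

(* The auctioneer commits one fake bid 1 + e under the true single-item constraint on all n + 1
   bids and conceals it exactly when it would win, i.e. when the highest real value lies in
   [1, 1 + e]; this costs the collateral f and has probability O(e). When one real value exceeds
   1 + e and all others are below 1, an event of probability bounded away from 0, the revealed
   fake bid raises the price from 1 to 1 + e; in no case does it lower the revenue. Up to o(e) the
   expected gain is therefore n e exp(-1) (1 - exp(-1))^(n-1) (1 - max f 0), positive if f < 1. *)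

section \<open>Single-item allocation with reserve 1\<close>

definition single_item :: "nat set \<Rightarrow> nat set set" where
  "single_item U = {S. S \<subseteq> U \<and> card S \<le> 1}"

abbreviation exp1_virtual_value :: "nat \<Rightarrow> real \<Rightarrow> real" where
  "exp1_virtual_value \<equiv> \<lambda>_ x. x - 1"

lemma matroid_single_item:
  assumes "finite U"
  shows "matroid U (single_item U)"
proof -
  have down_closed: "A \<in> single_item U" if "B \<in> single_item U" "A \<subseteq> B" for A B
    using that assms card_mono[of B A] finite_subset[of B U] unfolding single_item_def by auto
  have augment: "\<exists>x\<in>B - A. insert x A \<in> single_item U"
    if "A \<in> single_item U" "B \<in> single_item U" "card A < card B" for A B
  proof -
    have "finite A" "card B \<le> 1"
      using that assms finite_subset[of A U] unfolding single_item_def by auto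
    then have "card A = 0" "card B = 1" using that(3) by linarith+
    with \<open>finite A\<close> have "A = {}" by simp
    obtain x where "B = {x}" using \<open>card B = 1\<close> by (rule card_1_singletonE)
    then show ?thesis using that(2) \<open>A = {}\<close> by auto
  qed
  show ?thesis
    unfolding matroid_def
  proof (intro conjI)
    show "\<forall>A B. B \<in> single_item U \<longrightarrow> A \<subseteq> B \<longrightarrow> A \<in> single_item U"
      using down_closed by blast
    show "\<forall>A\<in>single_item U. \<forall>B\<in>single_item U. card A < card B
        \<longrightarrow> (\<exists>x\<in>B - A. insert x A \<in> single_item U)"
      using augment by blast
  qed (use assms in \<open>auto simp: single_item_def\<close>)
qed

lemma candidates_single_item:
  assumes "finite U" "R \<subseteq> U"
  shows "candidates (single_item U) R = insert {} ((\<lambda>i. {i}) ` R)"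
proof (intro set_eqI iffI)
  fix S assume S: "S \<in> candidates (single_item U) R"
  then have "S \<subseteq> R" "card S \<le> 1" unfolding candidates_def single_item_def by auto
  moreover have "finite S" using \<open>S \<subseteq> R\<close> finite_subset[OF assms(2,1)] by (rule finite_subset)
  ultimately consider "card S = 0" "finite S" | "card S = 1" by linarith
  then have "S = {} \<or> (\<exists>i. S = {i})"
    by cases (auto simp: card_1_singleton_iff)
  with \<open>S \<subseteq> R\<close> show "S \<in> insert {} ((\<lambda>i. {i}) ` R)" by auto
next
  fix S assume "S \<in> insert {} ((\<lambda>i. {i}) ` R)"
  then have "S \<subseteq> R" "card S \<le> 1" by auto
  with assms(2) show "S \<in> candidates (single_item U) R"
    unfolding candidates_def single_item_def by auto
qed

lemma lex_pref_asym:
  assumes "finite S" "finite T" "lex_pref S T"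
  shows "\<not> lex_pref T S"
proof
  assume "lex_pref T S"
  let ?D = "(S - T) \<union> (T - S)"
  have "Min ?D \<in> ?D" using assms by (intro Min_in) (auto simp: lex_pref_def)
  moreover have "(T - S) \<union> (S - T) = ?D" by auto
  ultimately show False using assms(3) \<open>lex_pref T S\<close> unfolding lex_pref_def by auto
qed

definition outranks :: "(nat \<Rightarrow> real \<Rightarrow> real) \<Rightarrow> (nat \<Rightarrow> real) \<Rightarrow> nat set \<Rightarrow> nat set \<Rightarrow> bool" where
  "outranks phi b S T \<longleftrightarrow> (\<Sum>i\<in>T. phi i (b i)) < (\<Sum>i\<in>S. phi i (b i))
        \<or> ((\<Sum>i\<in>T. phi i (b i)) = (\<Sum>i\<in>S. phi i (b i)) \<and> lex_pref S T)"

lemma outranks_asym: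
  assumes "finite S" "finite T" "outranks phi b S T"
  shows "\<not> outranks phi b T S"
  using assms lex_pref_asym[of S T] unfolding outranks_def by linarith

lemma alloc_eqI:
  assumes finite: "\<And>T. T \<in> candidates F R \<Longrightarrow> finite T"
    and S: "S \<in> candidates F R"
    and best: "\<And>T. T \<in> candidates F R \<Longrightarrow> T \<noteq> S \<Longrightarrow> outranks phi b S T"
  shows "alloc F phi b R = S"
  unfolding alloc_def outranks_def[symmetric]
proof (rule the_equality)
  show "S \<in> candidates F R \<and> (\<forall>T\<in>candidates F R. T \<noteq> S \<longrightarrow> outranks phi b S T)"
    using S best by blast
next
  fix S' assume S': "S' \<in> candidates F R \<and> (\<forall>T\<in>candidates F R. T \<noteq> S' \<longrightarrow> outranks phi b S' T)"
  show "S' = S"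
  proof (rule ccontr)
    assume "S' \<noteq> S"
    then have "outranks phi b S S'" "outranks phi b S' S" using best S S' by auto
    moreover have "finite S" "finite S'" using finite S S' by auto
    ultimately show False using outranks_asym by blast
  qed
qed

definition first_argmax :: "nat set \<Rightarrow> (nat \<Rightarrow> real) \<Rightarrow> nat \<Rightarrow> bool" where
  "first_argmax R b w \<longleftrightarrow> w \<in> R \<and> (\<forall>j\<in>R. b j \<le> b w) \<and> (\<forall>j\<in>R. j < w \<longrightarrow> b j < b w)"

lemma first_argmax_exists:
  assumes "finite R" "R \<noteq> {}"
  shows "\<exists>w. first_argmax R b w"
proof -
  define W where "W = {j\<in>R. b j = Max (b ` R)}"
  have "Max (b ` R) \<in> b ` R" using assms by (intro Max_in) auto
  then have "W \<noteq> {}" "finite W" using assms(1) unfolding W_def by auto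
  then have w: "Min W \<in> W" "\<And>j. j \<in> W \<Longrightarrow> Min W \<le> j" by auto
  have "b j < b (Min W)" if "j \<in> R" "j < Min W" for j
  proof -
    have "j \<notin> W" using that(2) w(2) by force
    moreover have "b j \<le> Max (b ` R)" using that(1) assms(1) by simp
    ultimately show ?thesis using w(1) that(1) unfolding W_def by auto
  qed
  then have "first_argmax R b (Min W)" using w(1) assms(1) unfolding first_argmax_def W_def by auto
  then show ?thesis ..
qed

lemma alloc_single_item_first_argmax:
  assumes U: "finite U" "R \<subseteq> U" and w: "first_argmax R b w" "1 \<le> b w"
  shows "alloc (single_item U) exp1_virtual_value b R = {w}"
proof (rule alloc_eqI)
  have top: "\<And>j. j \<in> R \<Longrightarrow> b j \<le> b w" and first: "\<And>j. j \<in> R \<Longrightarrow> j < w \<Longrightarrow> b j < b w"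
    using w(1) unfolding first_argmax_def by auto
  show "\<And>T. T \<in> candidates (single_item U) R \<Longrightarrow> finite T"
    and "{w} \<in> candidates (single_item U) R"
    using candidates_single_item[OF U] w(1) unfolding first_argmax_def by auto
  fix T assume "T \<in> candidates (single_item U) R" "T \<noteq> {w}"
  then consider "T = {}" | j where "j \<in> R" "T = {j}" "j \<noteq> w"
    using candidates_single_item[OF U] by auto
  then show "outranks exp1_virtual_value b {w} T"
  proof cases
    case 1
    then show ?thesis using w(2) unfolding outranks_def lex_pref_def by auto
  next
    case 2
    show ?thesis
    proof (cases "b j < b w")
      case True
      then show ?thesis using 2 unfolding outranks_def by auto
    next
      case False
      then have "b j = b w" using top[OF 2(1)] by simp
      moreover have "w < j" using first[OF 2(1)] False 2(3) by (meson linorder_neqE_nat)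
      moreover have "Min (({w} - {j}) \<union> ({j} - {w})) = w" using \<open>w < j\<close> by auto
      ultimately show ?thesis using 2 unfolding outranks_def lex_pref_def by auto
    qed
  qed
qed

lemma alloc_single_item_below_reserve:
  assumes U: "finite U" "R \<subseteq> U" and below: "\<And>j. j \<in> R \<Longrightarrow> b j < 1"
  shows "alloc (single_item U) exp1_virtual_value b R = {}"
proof (rule alloc_eqI)
  show "\<And>T. T \<in> candidates (single_item U) R \<Longrightarrow> finite T"
    and "{} \<in> candidates (single_item U) R"
    using candidates_single_item[OF U] by auto
  fix T assume "T \<in> candidates (single_item U) R" "T \<noteq> {}"
  then obtain j where "j \<in> R" "T = {j}" using candidates_single_item[OF U] by auto
  then show "outranks exp1_virtual_value b {} T" using below unfolding outranks_def by auto
qed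

lemma alloc_single_item_memD:
  assumes U: "finite U" "R \<subseteq> U" and w: "w \<in> alloc (single_item U) exp1_virtual_value b R"
  shows "w \<in> R" "1 \<le> b w" "\<And>j. j \<in> R \<Longrightarrow> b j \<le> b w"
proof -
  have "finite R" "R \<noteq> {}"
    using w alloc_single_item_below_reserve[OF U] finite_subset[OF U(2,1)] by auto
  then obtain t where t: "first_argmax R b t" using first_argmax_exists by blast
  have "1 \<le> b t"
  proof (rule ccontr)
    assume "\<not> 1 \<le> b t"
    then have "alloc (single_item U) exp1_virtual_value b R = {}"
      using t unfolding first_argmax_def by (intro alloc_single_item_below_reserve[OF U]) force
    then show False using w by simp
  qed
  then have "w = t" using alloc_single_item_first_argmax[OF U t] w by simp
  then show "w \<in> R" "1 \<le> b w" "\<And>j. j \<in> R \<Longrightarrow> b j \<le> b w"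
    using t \<open>1 \<le> b t\<close> unfolding first_argmax_def by auto
qed

lemma critical_bid_single_item:
  assumes U: "finite U" "R \<subseteq> U" and w: "w \<in> R"
  shows "critical_bid (single_item U) exp1_virtual_value b R w = Max (insert 1 (b ` (R - {w})))"
proof -
  have "finite R" using finite_subset[OF U(2,1)] .
  define m where "m = Max (insert 1 (b ` (R - {w})))"
  define X where "X = {x. 0 \<le> x \<and> w \<in> alloc (single_item U) exp1_virtual_value (b(w := x)) R}"
  have "1 \<le> m" "\<And>j. j \<in> R - {w} \<Longrightarrow> b j \<le> m" unfolding m_def using \<open>finite R\<close> by auto
  have above: "x \<in> X" if "m < x" for x
  proof -
    have "first_argmax R (b(w := x)) w"
      using that w \<open>\<And>j. j \<in> R - {w} \<Longrightarrow> b j \<le> m\<close> unfolding first_argmax_def by force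
    then have "alloc (single_item U) exp1_virtual_value (b(w := x)) R = {w}"
      using that \<open>1 \<le> m\<close> by (intro alloc_single_item_first_argmax[OF U]) auto
    then show ?thesis using that \<open>1 \<le> m\<close> unfolding X_def by simp
  qed
  have below: "m \<le> x" if "x \<in> X" for x
  proof -
    have win: "w \<in> alloc (single_item U) exp1_virtual_value (b(w := x)) R"
      using that unfolding X_def by simp
    have "b j \<le> x" if "j \<in> R - {w}" for j
      using alloc_single_item_memD(3)[OF U win, of j] that by simp
    then show ?thesis
      unfolding m_def using \<open>finite R\<close> alloc_single_item_memD(2)[OF U win] by (simp add: Max_le_iff)
  qed
  have "Inf X = m"
  proof (rule antisym)
    show "m \<le> Inf X" using above[of "m + 1"] below by (intro cInf_greatest) auto
    show "Inf X \<le> m"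
    proof (rule dense_ge)
      fix y assume "m < y"
      then show "Inf X \<le> y" using above below by (intro cInf_lower bdd_belowI) auto
    qed
  qed
  then show ?thesis unfolding critical_bid_def X_def m_def .
qed

lemma payments_single_item:
  assumes U: "finite U" "R \<subseteq> U" and w: "first_argmax R b w" "1 \<le> b w"
  shows "(\<Sum>i\<in>alloc (single_item U) exp1_virtual_value b R \<inter> K.
            critical_bid (single_item U) exp1_virtual_value b R i)
       = (if w \<in> K then Max (insert 1 (b ` (R - {w}))) else 0)"
  using alloc_single_item_first_argmax[OF U w] critical_bid_single_item[OF U] w(1)
  unfolding first_argmax_def by simp

section \<open>Revenue of the honest and of the shill strategy\<close>

definition max_value :: "nat \<Rightarrow> (nat \<Rightarrow> real) \<Rightarrow> real" where
  "max_value n v = Max (v ` {..<n})"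

definition price_against :: "nat \<Rightarrow> (nat \<Rightarrow> real) \<Rightarrow> nat \<Rightarrow> real" where
  "price_against n v i = Max (insert 1 (v ` ({..<n} - {i})))"

text \<open>Second-price auction with reserve 1. The winner pays the least of the prices faced by the
  bidders, so no winner has to be selected.\<close>
definition second_price_revenue :: "nat \<Rightarrow> (nat \<Rightarrow> real) \<Rightarrow> real" where
  "second_price_revenue n v =
     (if 1 \<le> max_value n v then Min (price_against n v ` {..<n}) else 0)"

text \<open>The fake bid \<open>n\<close> is concealed exactly when it would win.\<close>
definition shill_strategy :: "nat \<Rightarrow> real \<Rightarrow> strategy" where
  "shill_strategy n e =
     \<lparr>nfake = 1, fakebid = (\<lambda>_. 1 + e), vval = exp1_virtual_value, feas = single_item {..<n + 1},
      conceal = (\<lambda>v. if 1 \<le> max_value n v \<and> max_value n v \<le> 1 + e then {n} else {})\<rparr>"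

definition shill_revenue :: "nat \<Rightarrow> real \<Rightarrow> real \<Rightarrow> (nat \<Rightarrow> real) \<Rightarrow> real" where
  "shill_revenue n f e v =
     (if 1 \<le> max_value n v \<and> max_value n v \<le> 1 + e then second_price_revenue n v - f
      else if 1 + e < max_value n v then max (1 + e) (second_price_revenue n v) else 0)"

lemma first_argmax_lessThan_exists:
  assumes "n \<ge> 1"
  shows "\<exists>w. first_argmax {..<n} v w"
  using first_argmax_exists[of "{..<n}" v] assms by (simp add: lessThan_empty_iff)

lemma max_value_first_argmax:
  assumes "first_argmax {..<n} v w"
  shows "max_value n v = v w"
  using assms unfolding max_value_def first_argmax_def by (intro Max_eqI) auto

lemma second_price_revenue_top:
  assumes w: "first_argmax {..<n} v w" "1 \<le> v w"
  shows "second_price_revenue n v = price_against n v w"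
proof -
  have "Min (price_against n v ` {..<n}) = price_against n v w"
  proof (rule Min_eqI)
    fix y assume "y \<in> price_against n v ` {..<n}"
    then obtain i where i: "i < n" "y = price_against n v i" by auto
    have "price_against n v w \<le> v w"
      unfolding price_against_def using w unfolding first_argmax_def by (auto simp: Max_le_iff)
    also have "v w \<le> price_against n v i" if "i \<noteq> w"
      unfolding price_against_def using w that i unfolding first_argmax_def by (intro Max_ge) auto
    finally show "price_against n v w \<le> y" using i by (cases "i = w") auto
  qed (use w in \<open>auto simp: first_argmax_def\<close>)
  then show ?thesis
    unfolding second_price_revenue_def using w max_value_first_argmax[OF w(1)] by simp
qed

lemma payments_real_bidders:
  assumes "n \<ge> 1" "finite U" "{..<n} \<subseteq> U" and b: "\<And>j. j < n \<Longrightarrow> b j = v j"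
  shows "(\<Sum>i\<in>alloc (single_item U) exp1_virtual_value b {..<n} \<inter> {..<n}.
            critical_bid (single_item U) exp1_virtual_value b {..<n} i)
       = second_price_revenue n v"
proof -
  obtain w where w: "first_argmax {..<n} v w" using first_argmax_lessThan_exists[OF assms(1)] ..
  then have bw: "first_argmax {..<n} b w" using b unfolding first_argmax_def by auto
  show ?thesis
  proof (cases "1 \<le> v w")
    case True
    have "w < n" "b ` ({..<n} - {w}) = v ` ({..<n} - {w})"
      using b w unfolding first_argmax_def by auto
    then show ?thesis
      using payments_single_item[OF assms(2,3) bw] b True
      by (simp add: second_price_revenue_top[OF w] price_against_def)
  next
    case False
    have "b j < 1" if "j \<in> {..<n}" for j
      using bw b[of w] that False unfolding first_argmax_def by force
    then have "alloc (single_item U) exp1_virtual_value b {..<n} = {}"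
      by (rule alloc_single_item_below_reserve[OF assms(2,3)])
    then show ?thesis
      using False max_value_first_argmax[OF w] unfolding second_price_revenue_def by simp
  qed
qed

lemma DRA_revenue_honest:
  assumes "n \<ge> 1"
  shows "DRA_revenue n f (honest n) v = second_price_revenue n v"
proof -
  have "honest n = \<lparr>nfake = 0, fakebid = (\<lambda>_. 0), vval = exp1_virtual_value,
      feas = single_item {..<n}, conceal = (\<lambda>_. {})\<rparr>"
    unfolding honest_def single_item_def by simp
  then show ?thesis
    using payments_real_bidders[OF assms, of "{..<n}" "bids n (honest n) v" v]
    by (simp add: DRA_revenue_def revealed_def bids_def)
qed

lemma valid_shill_strategy: "valid_strategy n (shill_strategy n e)"
proof -
  have "card (S \<inter> {..<n}) \<le> 1" if "S \<in> single_item {..<n + 1}" for S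
    using that card_mono[of S "S \<inter> {..<n}"] finite_subset[of S "{..<n + 1}"]
    unfolding single_item_def by auto
  then show ?thesis
    unfolding valid_strategy_def shill_strategy_def
    by (auto simp: matroid_single_item mono_def)
qed

lemma price_against_Suc:
  assumes "w < n" "\<And>j. j < n \<Longrightarrow> b j = v j"
  shows "price_against (Suc n) b w = max (b n) (price_against n v w)"
proof -
  have "{..<Suc n} - {w} = insert n ({..<n} - {w})" using assms(1) by auto
  moreover have "b ` ({..<n} - {w}) = v ` ({..<n} - {w})" using assms(2) by (intro image_cong) auto
  ultimately have "insert 1 (b ` ({..<Suc n} - {w})) = insert (b n) (insert 1 (v ` ({..<n} - {w})))"
    by auto
  then show ?thesis unfolding price_against_def by (simp add: Max_insert)
qed

lemma payments_revealed_fake_bid: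
  assumes "n \<ge> 1" "e > 0" and b: "\<And>j. j < n \<Longrightarrow> b j = v j" "b n = 1 + e"
    and revealed: "\<not> (1 \<le> max_value n v \<and> max_value n v \<le> 1 + e)"
  shows "(\<Sum>i\<in>alloc (single_item {..<n + 1}) exp1_virtual_value b {..<n + 1} \<inter> {..<n}.
            critical_bid (single_item {..<n + 1}) exp1_virtual_value b {..<n + 1} i)
       = (if 1 + e < max_value n v then max (1 + e) (second_price_revenue n v) else 0)"
proof -
  obtain w where w: "first_argmax {..<n} v w" using first_argmax_lessThan_exists[OF assms(1)] ..
  have vw: "w < n" "\<And>j. j < n \<Longrightarrow> v j \<le> v w" "max_value n v = v w"
    using w max_value_first_argmax[OF w] unfolding first_argmax_def by auto
  have fin: "finite {..<n + 1}" by simp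
  show ?thesis
  proof (cases "1 + e < v w")
    case True
    then have "first_argmax {..<n + 1} b w"
      using w b vw(1) unfolding first_argmax_def by (auto simp: less_Suc_eq)
    then show ?thesis
      using payments_single_item[OF fin order_refl, of b w "{..<n}"] price_against_Suc[OF vw(1) b(1)]
        second_price_revenue_top[OF w] True b vw assms(2)
      by (simp add: price_against_def)
  next
    case False
    then have "v w < 1" using revealed vw(3) by linarith
    then have "b j < b n" if "j < n" for j using vw(2)[OF that] b assms(2) that by simp
    then have "first_argmax {..<n + 1} b n"
      unfolding first_argmax_def by (auto simp: less_Suc_eq less_imp_le)
    then show ?thesis
      using payments_single_item[OF fin order_refl, of b n "{..<n}"] False b assms(2) vw(3) by simp
  qed
qed

lemma DRA_revenue_shill:
  assumes "n \<ge> 1" "e > 0"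
  shows "DRA_revenue n f (shill_strategy n e) v = shill_revenue n f e v"
proof -
  let ?\<sigma> = "shill_strategy n e" and ?F = "single_item {..<n + 1}"
  define b where "b = bids n ?\<sigma> v"
  have b: "\<And>j. j < n \<Longrightarrow> b j = v j" "b n = 1 + e"
    unfolding b_def bids_def shill_strategy_def by simp_all
  have "feas ?\<sigma> = ?F" "vval ?\<sigma> = exp1_virtual_value" by (simp_all add: shill_strategy_def)
  then have rev: "DRA_revenue n f ?\<sigma> v =
      (\<Sum>i\<in>alloc ?F exp1_virtual_value b (revealed n ?\<sigma> v) \<inter> {..<n}.
         critical_bid ?F exp1_virtual_value b (revealed n ?\<sigma> v) i)
      - f * real (card (conceal ?\<sigma> v))"
    unfolding DRA_revenue_def Let_def b_def by simp
  show ?thesis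
  proof (cases "1 \<le> max_value n v \<and> max_value n v \<le> 1 + e")
    case True
    then have "conceal ?\<sigma> v = {n}" "revealed n ?\<sigma> v = {..<n}"
      by (auto simp: shill_strategy_def revealed_def)
    then show ?thesis
      unfolding rev using payments_real_bidders[OF assms(1) _ _ b(1)] True
      by (simp add: shill_revenue_def)
  next
    case False
    then have "conceal ?\<sigma> v = {}" "revealed n ?\<sigma> v = {..<n + 1}"
      by (auto simp: shill_strategy_def revealed_def)
    then show ?thesis
      unfolding rev shill_revenue_def if_not_P[OF False]
      using payments_revealed_fake_bid[OF assms b False] by simp
  qed
qed

section \<open>Exponential values\<close>

abbreviation value_space :: "nat \<Rightarrow> (nat \<Rightarrow> real) measure" where
  "value_space n \<equiv> PiM {..<n} (\<lambda>_. exp1)"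

lemma prob_space_exp1: "prob_space exp1"
  using prob_space_exponential_density[of 1] by simp

lemma prob_space_value_space: "prob_space (value_space n)"
  by (rule prob_space_PiM) (rule prob_space_exp1)

lemma measurable_value_component: "i < n \<Longrightarrow> (\<lambda>v. v i) \<in> borel_measurable (value_space n)"
  using measurable_component_singleton[of i "{..<n}" "\<lambda>_. exp1"]
  by (simp add: measurable_cong_sets[OF refl sets_density])

lemma borel_measurable_Max_insert:
  assumes "finite X" "\<And>j. j \<in> X \<Longrightarrow> (\<lambda>v. v j) \<in> borel_measurable M"
  shows "(\<lambda>v. Max (insert (c::real) (v ` X))) \<in> borel_measurable M"
  using assms
proof (induction X rule: finite_induct)
  case (insert a X)
  have "insert c (v ` insert a X) = insert (v a) (insert c (v ` X))" for v :: "'a \<Rightarrow> real"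
    by auto
  then have "Max (insert c (v ` insert a X)) = max (v a) (Max (insert c (v ` X)))" for v
    using insert(1) by simp
  then show ?case using insert by (simp add: borel_measurable_max)
qed simp

lemma borel_measurable_second_price_revenue:
  "second_price_revenue n \<in> borel_measurable (value_space n)"
proof -
  have "(\<lambda>v. price_against n v i) \<in> borel_measurable (value_space n)" for i
    unfolding price_against_def
    by (rule borel_measurable_Max_insert) (auto intro: measurable_value_component)
  moreover have "max_value n \<in> borel_measurable (value_space n)"
    unfolding max_value_def[abs_def]
    by (rule borel_measurable_Max) (auto intro: measurable_value_component)
  ultimately show ?thesis
    unfolding second_price_revenue_def[abs_def]
    using borel_measurable_Min[of "{..<n}" "\<lambda>i v. price_against n v i"] by measurable
qed

lemma borel_measurable_shill_revenue: "shill_revenue n f e \<in> borel_measurable (value_space n)"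
proof -
  have "max_value n \<in> borel_measurable (value_space n)"
    unfolding max_value_def[abs_def]
    by (rule borel_measurable_Max) (auto intro: measurable_value_component)
  then show ?thesis
    unfolding shill_revenue_def[abs_def] using borel_measurable_second_price_revenue[of n]
    by measurable
qed

lemma integrable_value_component:
  assumes "i < n"
  shows "integrable (value_space n) (\<lambda>v. v i)"
proof -
  have "distributed exp1 lborel (\<lambda>x. x) (erlang_density 0 1)"
    unfolding distributed_def by (simp add: distr_id2)
  then have "integrable exp1 (\<lambda>x. x)"
    using prob_space.erlang_ith_moment_integrable[OF prob_space_exp1, of 1 "\<lambda>x. x" 0 1] by simp
  moreover have "distr (value_space n) exp1 (\<lambda>v. v i) = exp1"
    using assms by (intro distr_PiM_component prob_space_exp1) auto
  ultimately have "integrable (distr (value_space n) exp1 (\<lambda>v. v i)) (\<lambda>x. x)" by simp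
  then show ?thesis
    using assms by (subst (asm) integrable_distr_eq) (auto intro: measurable_component_singleton)
qed

lemma price_against_bounds:
  "1 \<le> price_against n v i" "price_against n v i \<le> 1 + (\<Sum>j<n. \<bar>v j\<bar>)"
proof -
  have "\<bar>v j\<bar> \<le> (\<Sum>j<n. \<bar>v j\<bar>)" if "j < n" for j
    using that by (intro member_le_sum) auto
  moreover have "0 \<le> (\<Sum>j<n. \<bar>v j\<bar>)" by (intro sum_nonneg) auto
  ultimately show "price_against n v i \<le> 1 + (\<Sum>j<n. \<bar>v j\<bar>)"
    unfolding price_against_def by (force simp: Max_le_iff)
qed (simp add: price_against_def)

lemma second_price_revenue_bounds:
  assumes "n \<ge> 1"
  shows "0 \<le> second_price_revenue n v" "second_price_revenue n v \<le> 1 + (\<Sum>j<n. \<bar>v j\<bar>)"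
proof -
  have "Min (price_against n v ` {..<n}) \<in> price_against n v ` {..<n}"
    using assms by (intro Min_in) (auto simp: lessThan_empty_iff)
  moreover have "0 \<le> (\<Sum>j<n. \<bar>v j\<bar>)" by (intro sum_nonneg) auto
  ultimately show "0 \<le> second_price_revenue n v" "second_price_revenue n v \<le> 1 + (\<Sum>j<n. \<bar>v j\<bar>)"
    unfolding second_price_revenue_def using price_against_bounds[of n v]
    by (auto intro: order_trans[OF zero_le_one])
qed

lemma integrable_abs_sum_values: "integrable (value_space n) (\<lambda>v. c + (\<Sum>j<n. \<bar>v j\<bar>))"
proof -
  interpret prob_space "value_space n" by (rule prob_space_value_space)
  show ?thesis by (intro Bochner_Integration.integrable_add Bochner_Integration.integrable_sum
      integrable_abs integrable_value_component integrable_const) auto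
qed

lemma integrable_second_price_revenue:
  assumes "n \<ge> 1"
  shows "integrable (value_space n) (second_price_revenue n)"
proof (rule Bochner_Integration.integrable_bound[OF integrable_abs_sum_values[of n 1]])
  show "AE v in value_space n. norm (second_price_revenue n v) \<le> norm (1 + (\<Sum>j<n. \<bar>v j\<bar>))"
    using second_price_revenue_bounds[OF assms] by (intro AE_I2) auto
qed (rule borel_measurable_second_price_revenue)

lemma integrable_shill_revenue:
  assumes "n \<ge> 1"
  shows "integrable (value_space n) (shill_revenue n f e)"
proof (rule Bochner_Integration.integrable_bound
    [OF integrable_abs_sum_values[of n "\<bar>f\<bar> + \<bar>1 + e\<bar> + 1"]])
  show "AE v in value_space n.
      norm (shill_revenue n f e v) \<le> norm (\<bar>f\<bar> + \<bar>1 + e\<bar> + 1 + (\<Sum>j<n. \<bar>v j\<bar>))"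
  proof (intro AE_I2)
    fix v :: "nat \<Rightarrow> real"
    have "0 \<le> (\<Sum>j<n. \<bar>v j\<bar>)" by (intro sum_nonneg) auto
    with second_price_revenue_bounds[OF assms, of v]
    show "norm (shill_revenue n f e v) \<le> norm (\<bar>f\<bar> + \<bar>1 + e\<bar> + 1 + (\<Sum>j<n. \<bar>v j\<bar>))"
      unfolding shill_revenue_def by (auto simp: abs_if max_def)
  qed
qed (rule borel_measurable_shill_revenue)

lemma measure_exp1_atMost:
  assumes "0 \<le> a"
  shows "measure exp1 {..a} = 1 - exp (- a)"
proof -
  have "emeasure exp1 {..a} = ennreal (erlang_CDF 0 1 a)" by (rule emeasure_erlang_density) simp
  then show ?thesis using assms by (simp add: measure_def erlang_CDF_0)
qed

lemma measure_exp1_greaterThan: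
  assumes "0 \<le> a"
  shows "measure exp1 {a<..} = exp (- a)"
proof -
  interpret prob_space exp1 by (rule prob_space_exp1)
  have "measure exp1 {a<..} = 1 - measure exp1 {..a}"
    using prob_compl[of "{..a}"] by (simp add: Compl_eq_Diff_UNIV[symmetric])
  then show ?thesis using measure_exp1_atMost[OF assms] by simp
qed

lemma measure_exp1_singleton: "measure exp1 {x} = 0"
proof -
  have "AE t in lborel. t \<in> {x} \<longrightarrow> ennreal (exponential_density 1 t) = 0"
    using AE_lborel_singleton[of x] by (rule eventually_mono) auto
  then have "{x} \<in> null_sets exp1" by (subst null_sets_density_iff) auto
  then show ?thesis by (rule measure_eq_0_null_sets)
qed

lemma measure_exp1_atLeastAtMost:
  assumes "0 \<le> a" "a \<le> b"
  shows "measure exp1 {a..b} = exp (- a) - exp (- b)"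
proof -
  interpret prob_space exp1 by (rule prob_space_exp1)
  have "{a..b} = ({..b} - {..a}) \<union> {a}" using assms by auto
  moreover have "measure exp1 (({..b} - {..a}) \<union> {a}) = measure exp1 ({..b} - {..a}) + measure exp1 {a}"
    by (rule finite_measure_Union) auto
  ultimately have "measure exp1 {a..b} = measure exp1 ({..b} - {..a}) + measure exp1 {a}"
    by simp
  also have "measure exp1 ({..b} - {..a}) = measure exp1 {..b} - measure exp1 {..a}"
    using assms by (intro finite_measure_Diff) auto
  finally show ?thesis using assms by (simp add: measure_exp1_singleton measure_exp1_atMost)
qed

lemma measure_value_space_PiE:
  assumes "\<And>j. j < n \<Longrightarrow> S j \<in> sets borel"
  shows "measure (value_space n) (\<Pi>\<^sub>E j\<in>{..<n}. S j) = (\<Prod>j<n. measure exp1 (S j))"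
proof -
  interpret finite_product_prob_space "\<lambda>_. exp1" "{..<n}"
    unfolding finite_product_prob_space_def finite_product_sigma_finite_def product_prob_space_def
      product_prob_space_axioms_def product_sigma_finite_def finite_product_sigma_finite_axioms_def
    using prob_space_exp1 prob_space_imp_sigma_finite by simp
  show ?thesis using assms by (intro finite_measure_PiM_emb) auto
qed

text \<open>In \<open>sole_high\<close> the fake bid raises the price from 1 to \<open>1 + e\<close>; the events
  \<open>near_reserve\<close> cover the values for which the fake bid is concealed.\<close>
definition sole_high :: "nat \<Rightarrow> real \<Rightarrow> nat \<Rightarrow> (nat \<Rightarrow> real) set" where
  "sole_high n e i = (\<Pi>\<^sub>E j\<in>{..<n}. if j = i then {1 + e<..} else {..1})"

definition near_reserve :: "nat \<Rightarrow> real \<Rightarrow> nat \<Rightarrow> (nat \<Rightarrow> real) set" where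
  "near_reserve n e i = (\<Pi>\<^sub>E j\<in>{..<n}. if j = i then {1..1 + e} else {..1 + e})"

lemma measure_sole_high:
  assumes "i < n" "0 \<le> e"
  shows "measure (value_space n) (sole_high n e i) = exp (- (1 + e)) * (1 - exp (- 1)) ^ (n - 1)"
proof -
  have "measure (value_space n) (sole_high n e i)
      = (\<Prod>j<n. if j = i then exp (- (1 + e)) else 1 - exp (- 1))"
    unfolding sole_high_def using assms
    by (subst measure_value_space_PiE)
      (auto intro!: prod.cong simp: measure_exp1_atMost measure_exp1_greaterThan)
  then show ?thesis using assms(1) by (simp add: prod_gen_delta)
qed

lemma measure_near_reserve:
  assumes "i < n" "0 \<le> e"
  shows "measure (value_space n) (near_reserve n e i)
    = (exp (- 1) - exp (- (1 + e))) * (1 - exp (- (1 + e))) ^ (n - 1)"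
proof -
  have "measure (value_space n) (near_reserve n e i)
      = (\<Prod>j<n. if j = i then exp (- 1) - exp (- (1 + e)) else 1 - exp (- (1 + e)))"
    unfolding near_reserve_def using assms
    by (subst measure_value_space_PiE)
      (auto intro!: prod.cong simp: measure_exp1_atMost measure_exp1_atLeastAtMost)
  then show ?thesis using assms(1) by (simp add: prod_gen_delta)
qed

lemma mem_sole_high:
  assumes "v \<in> space (value_space n)" "i < n"
  shows "v \<in> sole_high n e i \<longleftrightarrow> 1 + e < v i \<and> (\<forall>j<n. j \<noteq> i \<longrightarrow> v j \<le> 1)"
  using assms unfolding sole_high_def by (auto simp: space_PiM PiE_iff)

lemma mem_near_reserve:
  assumes "v \<in> space (value_space n)" "i < n"
  shows "v \<in> near_reserve n e i \<longleftrightarrow> 1 \<le> v i \<and> (\<forall>j<n. v j \<le> 1 + e)"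
  using assms unfolding near_reserve_def by (auto simp: space_PiM PiE_iff)

section \<open>Expected gain of the shill strategy\<close>

lemma second_price_revenue_sole_high:
  assumes "v \<in> space (value_space n)" "i < n" "0 \<le> e" "v \<in> sole_high n e i"
  shows "second_price_revenue n v = 1"
proof -
  have high: "1 + e < v i" and low: "\<And>j. j < n \<Longrightarrow> j \<noteq> i \<Longrightarrow> v j \<le> 1"
    using assms(4) mem_sole_high[OF assms(1,2)] by auto
  then have "first_argmax {..<n} v i"
    using assms(2,3) unfolding first_argmax_def by (force simp: less_imp_le)
  moreover have "price_against n v i = 1"
    unfolding price_against_def using low by (intro Max_eqI) auto
  ultimately show ?thesis using second_price_revenue_top high assms(3) by simp
qed

lemma shill_gain_pointwise:
  assumes n: "n \<ge> 1" and e: "e > 0" and g: "f \<le> g" "0 \<le> g" and v: "v \<in> space (value_space n)"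
  shows "e * (\<Sum>i<n. indicator (sole_high n e i) v) - g * (\<Sum>i<n. indicator (near_reserve n e i) v)
    \<le> shill_revenue n f e v - second_price_revenue n v"
proof -
  define A where "A = {..<n} \<inter> {i. v \<in> sole_high n e i}"
  define B where "B = {..<n} \<inter> {i. v \<in> near_reserve n e i}"
  have sums: "(\<Sum>i<n. indicator (sole_high n e i) v) = real (card A)"
    "(\<Sum>i<n. indicator (near_reserve n e i) v) = real (card B)"
    unfolding A_def B_def indicator_def by simp_all
  obtain w where w: "first_argmax {..<n} v w" using first_argmax_lessThan_exists[OF n] ..
  have vw: "w < n" "\<And>j. j < n \<Longrightarrow> v j \<le> v w" "max_value n v = v w"
    using w max_value_first_argmax[OF w] unfolding first_argmax_def by auto
  consider (concealed) "1 \<le> v w" "v w \<le> 1 + e" | (high) "1 + e < v w" | (low) "v w < 1"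
    by linarith
  then show ?thesis
  proof cases
    case concealed
    have "A = {}" using vw concealed unfolding A_def by (force simp: mem_sole_high[OF v])
    moreover have "w \<in> B"
      using vw concealed unfolding B_def by (force simp: mem_near_reserve[OF v])
    then have "1 \<le> real (card B)" unfolding B_def by (auto simp: Suc_le_eq card_gt_0_iff)
    then have "g \<le> g * real (card B)" using mult_left_mono[of 1 "real (card B)" g] g by simp
    ultimately show ?thesis
      unfolding sums shill_revenue_def using concealed vw(3) g by simp
  next
    case high
    have "B = {}" using vw high e unfolding B_def by (force simp: mem_near_reserve[OF v])
    have "A \<subseteq> {w}" using vw high e unfolding A_def by (force simp: mem_sole_high[OF v])
    show ?thesis
    proof (cases "w \<in> A")
      case True
      then have "second_price_revenue n v = 1"
        using second_price_revenue_sole_high[OF v vw(1) less_imp_le[OF e]] unfolding A_def by simp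
      moreover have "A = {w}" using True \<open>A \<subseteq> {w}\<close> by auto
      ultimately show ?thesis
        unfolding sums shill_revenue_def \<open>B = {}\<close> using high vw(3) e by simp
    next
      case False
      then have "A = {}" using \<open>A \<subseteq> {w}\<close> by auto
      then show ?thesis
        unfolding sums shill_revenue_def \<open>B = {}\<close> using high vw(3) e by simp
    qed
  next
    case low
    have "A = {}" using vw low e unfolding A_def by (force simp: mem_sole_high[OF v])
    moreover have "B = {}" using vw low unfolding B_def by (force simp: mem_near_reserve[OF v])
    ultimately show ?thesis
      unfolding sums shill_revenue_def second_price_revenue_def using low vw(3) e by simp
  qed
qed

text \<open>\<open>e\<close> times the probability of one event \<open>sole_high\<close>, minus \<open>g\<close> times that of
  one event \<open>near_reserve\<close>.\<close>
definition shill_margin :: "nat \<Rightarrow> real \<Rightarrow> real \<Rightarrow> real" where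
  "shill_margin n g e = e * (exp (- (1 + e)) * (1 - exp (- 1)) ^ (n - 1))
     - g * ((exp (- 1) - exp (- (1 + e))) * (1 - exp (- (1 + e))) ^ (n - 1))"

lemma shill_margin_positive:
  assumes "0 \<le> g" "g < 1"
  shows "\<exists>e>0. 0 < shill_margin n g e"
proof -
  define c where "c = (1 - exp (- 1 :: real)) ^ (n - 1)"
  define d where "d e = (1 - exp (- (1 + e))) ^ (n - 1)" for e :: real
  define \<phi> where "\<phi> e = exp (- e) * c - g * d e" for e
  have "(\<phi> \<longlongrightarrow> \<phi> 0) (at_right 0)" unfolding \<phi>_def d_def by (intro tendsto_intros)
  moreover have "0 < \<phi> 0" unfolding \<phi>_def d_def c_def using assms by simp
  ultimately have "eventually (\<lambda>e. 0 < \<phi> e) (at_right 0)" by (rule order_tendstoD(1))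
  then obtain b where b: "b > 0" "\<And>e. 0 < e \<Longrightarrow> e < b \<Longrightarrow> 0 < \<phi> e"
    unfolding eventually_at_right_field by auto
  define e where "e = b / 2"
  have e: "0 < e" "0 < \<phi> e" using b unfolding e_def by auto
  have ee: "exp (- (1 + e)) = exp (- 1) * exp (- e)" by (simp add: exp_add[symmetric])
  have "0 \<le> d e" unfolding d_def using e(1) by simp
  have "exp (- 1) - exp (- (1 + e)) = exp (- 1) * (1 - exp (- e))" unfolding ee by algebra
  also have "\<dots> \<le> exp (- 1) * e" using exp_ge_add_one_self[of "- e"] by simp
  finally have "g * ((exp (- 1) - exp (- (1 + e))) * d e) \<le> g * (exp (- 1) * e * d e)"
    using assms(1) \<open>0 \<le> d e\<close> by (intro mult_left_mono mult_right_mono) auto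
  moreover have "shill_margin n g e
      = e * (exp (- (1 + e)) * c) - g * ((exp (- 1) - exp (- (1 + e))) * d e)"
    unfolding shill_margin_def c_def d_def by simp
  moreover have "e * (exp (- (1 + e)) * c) - g * (exp (- 1) * e * d e) = e * exp (- 1) * \<phi> e"
    unfolding \<phi>_def ee by (simp add: algebra_simps)
  ultimately have "e * exp (- 1) * \<phi> e \<le> shill_margin n g e" by linarith
  moreover have "0 < e * exp (- 1) * \<phi> e" using e by simp
  ultimately show ?thesis using e(1) by auto
qed

lemma expected_shill_gain:
  assumes n: "n \<ge> 1" and e: "e > 0" and g: "f \<le> g" "0 \<le> g"
  shows "real n * shill_margin n g e
    \<le> expected_revenue n f (shill_strategy n e) - expected_revenue n f (honest n)"
proof -
  interpret prob_space "value_space n" by (rule prob_space_value_space)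
  define L where "L v = e * (\<Sum>i<n. indicator (sole_high n e i) v)
      - g * (\<Sum>i<n. indicator (near_reserve n e i) v :: real)" for v
  have sets: "sole_high n e i \<in> sets (value_space n)" "near_reserve n e i \<in> sets (value_space n)" for i
    unfolding sole_high_def near_reserve_def by (auto intro!: sets_PiM_I_finite)
  then have "integrable (value_space n) L"
    unfolding L_def by (intro Bochner_Integration.integrable_diff integrable_mult_right
        Bochner_Integration.integrable_sum integrable_real_indicator) (auto simp: emeasure_eq_measure)
  have "real n * shill_margin n g e
    = e * (\<Sum>i<n. prob (sole_high n e i)) - g * (\<Sum>i<n. prob (near_reserve n e i))"
    using e by (simp add: shill_margin_def measure_sole_high measure_near_reserve algebra_simps)
  also have "\<dots> = integral\<^sup>L (value_space n) L"
    unfolding L_def using sets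
    by (simp add: Bochner_Integration.integral_diff Bochner_Integration.integral_sum
        integrable_real_indicator emeasure_eq_measure)
  also have "\<dots>
      \<le> integral\<^sup>L (value_space n) (\<lambda>v. shill_revenue n f e v - second_price_revenue n v)"
    using \<open>integrable (value_space n) L\<close> shill_gain_pointwise[OF n e g, folded L_def]
    by (intro integral_mono Bochner_Integration.integrable_diff integrable_shill_revenue
        integrable_second_price_revenue n)
  also have "\<dots> = expected_revenue n f (shill_strategy n e) - expected_revenue n f (honest n)"
    unfolding expected_revenue_def DRA_revenue_shill[OF n e] DRA_revenue_honest[OF n]
    using integrable_shill_revenue[OF n] integrable_second_price_revenue[OF n]
    by (rule Bochner_Integration.integral_diff)
  finally show ?thesis .
qed

theorem mainTheorem6:
  fixes n :: nat and f :: real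
  assumes "n \<ge> 1" and "f < 1"
  shows "\<not> DRA_credible n f"
proof
  assume credible: "DRA_credible n f"
  define g where "g = max f 0"
  have g: "f \<le> g" "0 \<le> g" "g < 1" using assms(2) unfolding g_def by auto
  then obtain e where "e > 0" "0 < shill_margin n g e" using shill_margin_positive by blast
  then have "0 < real n * shill_margin n g e" using assms(1) by simp
  also have "\<dots> \<le> expected_revenue n f (shill_strategy n e) - expected_revenue n f (honest n)"
    using assms(1) \<open>e > 0\<close> g(1,2) by (rule expected_shill_gain)
  also have "\<dots> \<le> 0" using credible valid_shill_strategy unfolding DRA_credible_def by simp
  finally show False by simp
qed

end
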